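(* Let $\mathcal{H}$ be an infinite-dimensional separable real Hilbert space. The Polish group $\mathrm{Isom}(\mathcal{H})$ is minimal: there is no Hausdorff group topology on $\mathrm{Isom}(\mathcal{H})$ strictly coarser than the topology of pointwise convergence on $\mathcal{H}$.
   Context: $\mathrm{Isom}(\mathcal{H})$ is the group of all isometries of $\mathcal{H}$ for the norm metric, endowed with the topology of pointwise convergence (the coarsest group topology making all orbit maps $g\mapsto gx$, $x\in\mathcal{H}$, continuous), which is Polish. *)

theory Defs
  imports "HOL-Analysis.Analysis" "HOL-Algebra.Group"
begin

text \<open>Topological groups with an explicit carrier: a topology \<open>T\<close> on the carrier of a group \<open>G\<close>.\<close>

definition group_topology :: "('g, 'm) monoid_scheme \<Rightarrow> 'g topology \<Rightarrow> bool" where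
  "group_topology G T \<longleftrightarrow>
     group G \<and> topspace T = carrier G \<and>
     continuous_map (prod_topology T T) T (\<lambda>(x, y). x \<otimes>\<^bsub>G\<^esub> y) \<and>
     continuous_map T T (\<lambda>x. inv\<^bsub>G\<^esub> x)"

definition Polish_group :: "('g, 'm) monoid_scheme \<Rightarrow> 'g topology \<Rightarrow> bool" where
  "Polish_group G T \<longleftrightarrow>
     group_topology G T \<and> second_countable T \<and> completely_metrizable_space T"

definition strictly_coarser :: "'g topology \<Rightarrow> 'g topology \<Rightarrow> bool" where
  "strictly_coarser S T \<longleftrightarrow>
     topspace S = topspace T \<and> (\<forall>U. openin S U \<longrightarrow> openin T U) \<and> S \<noteq> T"

definition minimal_group :: "('g, 'm) monoid_scheme \<Rightarrow> 'g topology \<Rightarrow> bool" where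
  "minimal_group G T \<longleftrightarrow>
     group_topology G T \<and> Hausdorff_space T \<and>
     \<not> (\<exists>S. group_topology G S \<and> Hausdorff_space S \<and> strictly_coarser S T)"

text \<open>Isometries are bijective and need not be linear: translations are included.\<close>

definition Isom :: "('a::metric_space \<Rightarrow> 'a) monoid" where
  "Isom = \<lparr>carrier = {g. bij g \<and> (\<forall>x y. dist (g x) (g y) = dist x y)},
           mult = (\<lambda>g h. g \<circ> h), one = id\<rparr>"

text \<open>The topology induced by the product topology on all maps is the coarsest one
  making every orbit map \<open>g \<mapsto> g x\<close> continuous, for the norm topology on the space.\<close>

definition pointwise_topology :: "('a::metric_space \<Rightarrow> 'a) topology" where
  "pointwise_topology =
     subtopology (product_topology (\<lambda>_. euclidean) UNIV) (carrier Isom)"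

definition infinite_dimensional :: "'a::real_vector itself \<Rightarrow> bool" where
  "infinite_dimensional _ \<longleftrightarrow> \<not> (\<exists>B :: 'a set. finite B \<and> span B = UNIV)"

end

theory Submission
  imports Defs
begin

text \<open>
  Let \<open>S\<close> be a Hausdorff group topology coarser than the pointwise one. By transitivity it is
  enough that \<open>g \<mapsto> g 0\<close> is \<open>S\<close>-continuous at the identity.
  The commutator of \<open>g\<close> with the reflection \<open>x \<mapsto> - x\<close> is the translation by
  \<open>2 g 0\<close>, and its \<open>n\<close>-th power is the translation by \<open>2 n g 0\<close>. So if some
  \<open>S\<close>-neighbourhood of the identity contains only translations of bounded length, then
  \<open>g 0\<close> is small for \<open>g\<close> near the identity, as desired.
  Otherwise every neighbourhood contains arbitrarily long translations. It also contains the rotations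
  by small angles, because \<open>S\<close> is coarser, and a small rotation \<open>r\<close> moves a long vector
  \<open>v\<close> far: the translation by \<open>r v - r\<^sup>-\<^sup>1 v\<close> is a word in \<open>r\<close> and the
  translation by \<open>v\<close>. Using such words twice, a fixed nontrivial translation lies in every
  neighbourhood of the identity, contradicting the Hausdorff property.
\<close>

section \<open>The group of isometries and its pointwise topology\<close>

lemma Isom_carrier: "g \<in> carrier Isom \<longleftrightarrow> bij g \<and> (\<forall>x y. dist (g x) (g y) = dist x y)"
  by (simp add: Isom_def)

lemma Isom_mult [simp]: "g \<otimes>\<^bsub>Isom\<^esub> h = g \<circ> h"
  and Isom_one [simp]: "\<one>\<^bsub>Isom\<^esub> = id"
  by (simp_all add: Isom_def)

lemma Isom_dist: "g \<in> carrier Isom \<Longrightarrow> dist (g x) (g y) = dist x y"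
  by (simp add: Isom_carrier)

lemma Isom_inv_into:
  assumes "g \<in> carrier Isom"
  shows "inv_into UNIV g \<in> carrier Isom"
    and "g (inv_into UNIV g x) = x" and "inv_into UNIV g (g x) = x"
proof -
  have b: "bij g" using assms by (simp add: Isom_carrier)
  show 1: "g (inv_into UNIV g x) = x" for x
    using b by (simp add: bij_is_surj surj_f_inv_f)
  show "inv_into UNIV g (g x) = x"
    using b by (simp add: bij_is_inj)
  show "inv_into UNIV g \<in> carrier Isom"
    using b assms by (metis 1 Isom_carrier bij_imp_bij_inv)
qed

lemma group_Isom: "group Isom"
proof (rule groupI)
  show "x \<otimes>\<^bsub>Isom\<^esub> y \<in> carrier Isom" if "x \<in> carrier Isom" "y \<in> carrier Isom" for x y :: "'a \<Rightarrow> 'a"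
    using that by (simp add: Isom_carrier bij_comp)
  show "\<one>\<^bsub>Isom\<^esub> \<in> carrier Isom"
    by (simp add: Isom_carrier)
  show "\<exists>y\<in>carrier Isom. y \<otimes>\<^bsub>Isom\<^esub> x = \<one>\<^bsub>Isom\<^esub>" if "x \<in> carrier Isom" for x :: "'a \<Rightarrow> 'a"
    using that by (intro bexI [of _ "inv_into UNIV x"]) (auto simp: fun_eq_iff Isom_inv_into)
qed (auto simp: comp_assoc)

lemma Isom_inv:
  assumes "g \<in> carrier Isom"
  shows "inv\<^bsub>Isom\<^esub> g = inv_into UNIV g"
proof (rule group.inv_equality [OF group_Isom])
  show "inv_into UNIV g \<otimes>\<^bsub>Isom\<^esub> g = \<one>\<^bsub>Isom\<^esub>"
    using assms by (simp add: fun_eq_iff Isom_inv_into)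
qed (use assms Isom_inv_into in auto)

lemma pointwise_topology_eq: "pointwise_topology = top_of_set (carrier Isom)"
  by (simp add: pointwise_topology_def euclidean_product_topology)

lemma topspace_pointwise_topology [simp]: "topspace pointwise_topology = carrier Isom"
  by (simp add: pointwise_topology_eq)

lemma continuous_map_euclidean_metric:
  fixes f :: "'b \<Rightarrow> 'a::metric_space"
  shows "continuous_map X euclidean f \<longleftrightarrow>
    (\<forall>x\<in>topspace X. \<forall>e>0. \<exists>U. openin X U \<and> x \<in> U \<and> (\<forall>y\<in>U. dist (f y) (f x) < e))"
  using Met_TC.continuous_map_to_metric [of X f] by (simp add: dist_commute)

lemma continuous_map_into_pointwise_topology:
  "continuous_map X pointwise_topology f \<longleftrightarrow>
     (\<forall>x. continuous_map X euclidean (\<lambda>g. f g x)) \<and> f \<in> topspace X \<rightarrow> carrier Isom"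
  by (simp add: pointwise_topology_def continuous_map_in_subtopology continuous_map_componentwise_UNIV)

lemma openin_pointwise_ball:
  "openin pointwise_topology {h \<in> carrier Isom. dist (h x) y < e}"
proof -
  have "open {h. dist (h x) y < e}"
    by (intro open_Collect_less continuous_intros continuous_on_product_coordinates)
  then show ?thesis
    by (auto simp: pointwise_topology_eq openin_subtopology)
qed

text \<open>A basic open box of the product restricts only finitely many coordinates, so the
  smallest of finitely many radii serves as \<open>e\<close>.\<close>

lemma pointwise_topology_neighbourhood:
  assumes "openin pointwise_topology U" "g \<in> U"
  obtains X e where "finite X" "e > 0"
    "\<And>h. h \<in> carrier Isom \<Longrightarrow> (\<And>x. x \<in> X \<Longrightarrow> dist (h x) (g x) < e) \<Longrightarrow> h \<in> U"
proof -
  obtain V where V: "openin (product_topology (\<lambda>_. euclidean) UNIV) V" "U = V \<inter> carrier Isom"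
    using assms(1) by (auto simp: pointwise_topology_def openin_subtopology)
  obtain Y where Y: "g \<in> (\<Pi>\<^sub>E i\<in>UNIV. Y i)" "\<And>i. open (Y i)" "finite {i. Y i \<noteq> UNIV}"
      "(\<Pi>\<^sub>E i\<in>UNIV. Y i) \<subseteq> V"
    using product_topology_open_contains_basis [OF V(1), of g] assms(2) V(2) by auto
  have "\<forall>i. \<exists>e>0. ball (g i) e \<subseteq> Y i"
    using Y by (auto simp: PiE_iff open_contains_ball)
  then obtain r where r: "\<And>i. r i > 0" "\<And>i. ball (g i) (r i) \<subseteq> Y i"
    by metis
  \<comment> \<open>The inserted 1 keeps \<open>Min\<close> meaningful when no coordinate is
    restricted.\<close>
  define e where "e = Min (insert 1 (r ` {i. Y i \<noteq> UNIV}))"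
  have e0: "e > 0" using Y(3) r(1) by (simp add: e_def)
  have er: "e \<le> r i" if "Y i \<noteq> UNIV" for i
    using that Y(3) by (simp add: e_def)
  show ?thesis
  proof (rule that [OF Y(3) e0])
    fix h assume h: "h \<in> carrier Isom" "\<And>x. x \<in> {i. Y i \<noteq> UNIV} \<Longrightarrow> dist (h x) (g x) < e"
    have "h i \<in> Y i" for i
    proof (cases "Y i = UNIV")
      case False
      then have "h i \<in> ball (g i) (r i)"
        using h(2)[of i] er[of i] by (simp add: dist_commute)
      then show ?thesis using r by blast
    qed simp
    then show "h \<in> U" using Y(4) V(2) h(1) by (auto simp: PiE_iff)
  qed
qed

lemma group_topology_pointwise: "group_topology Isom pointwise_topology"
  unfolding group_topology_def
proof (intro conjI)
  show "group Isom" by (rule group_Isom)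
  show "continuous_map (prod_topology pointwise_topology pointwise_topology) pointwise_topology
      (\<lambda>(x, y). x \<otimes>\<^bsub>Isom\<^esub> y :: 'a \<Rightarrow> 'a)"
    unfolding continuous_map_into_pointwise_topology continuous_map_euclidean_metric
  proof (intro conjI allI ballI impI)
    fix x :: 'a and p :: "('a \<Rightarrow> 'a) \<times> ('a \<Rightarrow> 'a)" and e :: real
    assume p: "p \<in> topspace (prod_topology pointwise_topology pointwise_topology)" and e: "e > 0"
    obtain g h where gh: "p = (g, h)" "g \<in> carrier Isom" "h \<in> carrier Isom"
      using p by auto
    \<comment> \<open>Replacing \<open>h' x\<close> by \<open>h x\<close> inside the isometry
      \<open>g'\<close> costs exactly \<open>dist (h' x) (h x)\<close>, so it is enough to control
      the first factor at \<open>h x\<close> and the second at \<open>x\<close>.\<close>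
    let ?U = "{k \<in> carrier Isom. dist (k (h x)) (g (h x)) < e/2} \<times>
              {k \<in> carrier Isom. dist (k x) (h x) < e/2}"
    have U: "openin (prod_topology pointwise_topology pointwise_topology) ?U"
      by (simp add: openin_prod_Times_iff openin_pointwise_ball del: less_divide_eq_numeral1)
    have "dist (g' (h' x)) (g (h x)) < e"
      if "g' \<in> carrier Isom" "dist (g' (h x)) (g (h x)) < e/2" "dist (h' x) (h x) < e/2" for g' h'
      using that dist_triangle [of "g' (h' x)" "g (h x)" "g' (h x)"] by (simp add: Isom_dist)
    then show "\<exists>U. openin (prod_topology pointwise_topology pointwise_topology) U \<and> p \<in> U \<and>
        (\<forall>y\<in>U. dist ((case y of (x, y) \<Rightarrow> x \<otimes>\<^bsub>Isom\<^esub> y) x) ((case p of (x, y) \<Rightarrow> x \<otimes>\<^bsub>Isom\<^esub> y) x) < e)"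
      using gh e by (intro exI [of _ ?U] conjI U) auto
  qed (use group.is_monoid [OF group_Isom, THEN monoid.m_closed] in auto)
  show "continuous_map pointwise_topology pointwise_topology (\<lambda>x. inv\<^bsub>Isom\<^esub> x :: 'a \<Rightarrow> 'a)"
    unfolding continuous_map_into_pointwise_topology continuous_map_euclidean_metric
  proof (intro conjI allI ballI impI)
    fix x :: 'a and g :: "'a \<Rightarrow> 'a" and e :: real
    assume g: "g \<in> topspace pointwise_topology" and e: "e > 0"
    \<comment> \<open>Controlling \<open>k\<close> at the preimage \<open>y\<close> of
      \<open>x\<close> is enough: applying \<open>k\<close> turns the distance from the inverse
      image of \<open>x\<close> under \<open>k\<close> to \<open>y\<close> into
      \<open>dist (g y) (k y)\<close>.\<close>
    define y where "y = (inv\<^bsub>Isom\<^esub> g) x"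
    have gy: "g y = x" using g by (simp add: y_def Isom_inv Isom_inv_into)
    let ?U = "{k \<in> carrier Isom. dist (k y) (g y) < e}"
    have "dist ((inv\<^bsub>Isom\<^esub> k) x) y < e" if k: "k \<in> ?U" for k
    proof -
      have "dist (inv_into UNIV k x) y = dist (k (inv_into UNIV k x)) (k y)"
        using k by (simp add: Isom_dist)
      also have "\<dots> = dist (g y) (k y)" using k gy by (simp add: Isom_inv_into)
      finally show ?thesis using k by (simp add: Isom_inv dist_commute)
    qed
    then show "\<exists>U. openin pointwise_topology U \<and> g \<in> U \<and>
        (\<forall>y\<in>U. dist ((inv\<^bsub>Isom\<^esub> y) x) ((inv\<^bsub>Isom\<^esub> g) x) < e)"
      using e g by (intro exI [of _ ?U]) (auto simp: openin_pointwise_ball simp flip: y_def)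
  qed (use group.inv_closed [OF group_Isom] in auto)
qed simp

lemma Hausdorff_pointwise: "Hausdorff_space (pointwise_topology :: ('a::metric_space \<Rightarrow> 'a) topology)"
  unfolding pointwise_topology_def
  by (intro Hausdorff_space_subtopology) (simp add: Hausdorff_space_product_topology)

section \<open>The pointwise topology is Polish\<close>

text \<open>The sets \<open>N Q\<close> for finite \<open>Q\<close> form a countable base.
  Isometries are equicontinuous, so conditions at arbitrary points can be replaced by conditions at
  the dense points \<open>d m\<close>.\<close>

lemma second_countable_pointwise:
  fixes d :: "nat \<Rightarrow> 'a::metric_space"
  assumes d: "closure (range d) = UNIV"
  shows "second_countable (pointwise_topology :: ('a \<Rightarrow> 'a) topology)"
proof -
  define N :: "(nat \<times> nat \<times> rat) set \<Rightarrow> ('a \<Rightarrow> 'a) set" where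
    "N Q = {h \<in> carrier Isom. \<forall>(m, n, r)\<in>Q. dist (h (d m)) (d n) < of_rat r}" for Q
  have near: "\<exists>n. dist x (d n) < e" if "e > 0" for x e
    using d closure_approachable[of x "range d"] that by (auto simp: dist_commute)
  have "openin pointwise_topology (N Q)" if "finite Q" for Q
  proof -
    have "N Q = (\<Inter>q\<in>Q. {h \<in> carrier Isom. dist (h (d (fst q))) (d (fst (snd q))) < of_rat (snd (snd q))})
        \<inter> topspace pointwise_topology"
      by (fastforce simp: N_def)
    also have "openin pointwise_topology \<dots>"
      by (intro openin_INT openin_pointwise_ball that)
    finally show ?thesis .
  qed
  moreover have "\<exists>Q. finite Q \<and> g \<in> N Q \<and> N Q \<subseteq> U" if U: "openin pointwise_topology U" "g \<in> U" for U g
  proof -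
    have g: "g \<in> carrier Isom" using U openin_subset by fastforce
    obtain X e where X: "finite X" "e > 0"
        "\<And>h. h \<in> carrier Isom \<Longrightarrow> (\<And>x. x \<in> X \<Longrightarrow> dist (h x) (g x) < e) \<Longrightarrow> h \<in> U"
      using pointwise_topology_neighbourhood [OF U] by metis
    \<comment> \<open>The triangle inequality below has four terms, each less than
      \<open>r\<close>.\<close>
    obtain r where r: "0 < real_of_rat r" "real_of_rat r < e/4"
      using of_rat_dense [of 0 "e/4"] X(2) by auto
    obtain m where m: "\<And>x. dist x (d (m x)) < of_rat r"
      using near r(1) by metis
    \<comment> \<open>Neither \<open>x\<close> nor \<open>g (d (m x))\<close> need lie on the
      sequence, so both are replaced by nearby terms of it.\<close>
    define Q where "Q = (\<lambda>x. (m x, m (g (d (m x))), r)) ` X"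
    have "dist (h x) (g x) < e" if "x \<in> X" "h \<in> N Q" for h x
    proof -
      let ?y = "d (m x)" and ?z = "d (m (g (d (m x))))"
      have h: "h \<in> carrier Isom" "dist (h ?y) ?z < of_rat r"
        using that by (auto simp: N_def Q_def)
      have "dist (h x) (g x) \<le> dist (h x) (h ?y) + dist (h ?y) ?z + dist ?z (g ?y) + dist (g ?y) (g x)"
        by metric
      also have "\<dots> = dist x ?y + dist (h ?y) ?z + dist (g ?y) ?z + dist x ?y"
        using h g by (simp add: Isom_dist dist_commute)
      also have "\<dots> < e"
        using h(2) m[of x] m[of "g ?y"] r(2) by linarith
      finally show ?thesis .
    qed
    then have "N Q \<subseteq> U" using X(3) by (auto simp: N_def)
    moreover have "g \<in> N Q" using g m by (auto simp: N_def Q_def)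
    moreover have "finite Q" using X by (simp add: Q_def)
    ultimately show ?thesis by blast
  qed
  ultimately show ?thesis
    unfolding second_countable_def
    by (intro exI [of _ "N ` {Q. finite Q}"]) (auto intro!: countable_image countable_Collect_finite)
qed

text \<open>A distance-preserving map on a dense set is uniformly continuous and so extends by
  completeness. Preserving distances is a closed condition on pairs, hence it passes to the
  extension.\<close>

lemma isometry_extension:
  fixes d :: "nat \<Rightarrow> 'a::complete_space"
  assumes d: "closure (range d) = UNIV" and p: "\<And>m n. dist (p m) (p n) = dist (d m) (d n)"
  obtains P :: "'a \<Rightarrow> 'a" where "\<And>n. P (d n) = p n" "\<And>x y. dist (P x) (P y) = dist x y"
proof -
  \<comment> \<open>The sequence \<open>d\<close> may repeat values; the choice of index is harmless
    because equal terms of \<open>d\<close> have equal images under \<open>p\<close>.\<close>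
  define f where "f x = p (inv_into UNIV d x)" for x
  have f: "f (d n) = p n" for n
  proof -
    have "d (inv_into UNIV d (d n)) = d n" by (simp add: f_inv_into_f)
    then have "dist (p (inv_into UNIV d (d n))) (p n) = 0" using p by simp
    then show ?thesis by (simp add: f_def)
  qed
  have "uniformly_continuous_on (range d) f"
    unfolding uniformly_continuous_on_def by (auto simp: f p)
  then obtain P where P: "uniformly_continuous_on UNIV P" "\<And>x. x \<in> range d \<Longrightarrow> f x = P x"
    using uniformly_continuous_on_extension_on_closure [of "range d" f] d by metis
  have cP: "continuous_on UNIV P" using P(1) by (rule uniformly_continuous_imp_continuous)
  have Pd: "P (d n) = p n" for n using P(2) f by (metis rangeI)
  have "closed {z. dist (P (fst z)) (P (snd z)) = dist (fst z) (snd z)}"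
    by (intro closed_Collect_eq continuous_intros continuous_on_compose2 [OF cP]) auto
  moreover have "range d \<times> range d \<subseteq> {z. dist (P (fst z)) (P (snd z)) = dist (fst z) (snd z)}"
    by (auto simp: Pd p)
  ultimately have cl: "closure (range d \<times> range d) \<subseteq> {z. dist (P (fst z)) (P (snd z)) = dist (fst z) (snd z)}"
    by (rule closure_minimal [rotated])
  then have "dist (P x) (P y) = dist x y" for x y
    using subsetD [OF cl, of "(x, y)"] by (simp add: closure_Times d)
  then show ?thesis using that Pd by blast
qed

text \<open>An isometry is recorded together with its inverse on a dense sequence:
  the set of all such records is closed.\<close>

lemma completely_metrizable_pointwise:
  fixes d :: "nat \<Rightarrow> 'a::complete_space"
  assumes d: "closure (range d) = UNIV"
  shows "completely_metrizable_space (pointwise_topology :: ('a \<Rightarrow> 'a) topology)"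
proof -
  define \<phi> :: "('a \<Rightarrow> 'a) \<Rightarrow> (nat \<Rightarrow> 'a) \<times> (nat \<Rightarrow> 'a)"
    where "\<phi> g = (\<lambda>n. g (d n), \<lambda>n. (inv\<^bsub>Isom\<^esub> g) (d n))" for g
  \<comment> \<open>The third condition ties the two sequences together: it is the trace on
    \<open>d\<close> of \<open>dist (g x) y = dist x (h y)\<close>, which forces \<open>h\<close> to
    be the inverse of \<open>g\<close>. All three are closed conditions.\<close>
  define C where "C = {z :: (nat \<Rightarrow> 'a) \<times> (nat \<Rightarrow> 'a).
      (\<forall>m n. dist (fst z m) (fst z n) = dist (d m) (d n)) \<and>
      (\<forall>m n. dist (snd z m) (snd z n) = dist (d m) (d n)) \<and>
      (\<forall>m n. dist (fst z m) (d n) = dist (d m) (snd z n))}"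
  have near: "\<exists>n. dist x (d n) < e" if "e > 0" for x e
    using d closure_approachable[of x "range d"] that by (auto simp: dist_commute)
  have ext_eq: "P = Q" if "\<And>n. P (d n) = Q (d n)" "\<And>x y. dist (P x) (P y) = dist x y"
      "\<And>x y. dist (Q x) (Q y) = dist x y" for P Q :: "'a \<Rightarrow> 'a"
  proof (rule ext, rule ccontr)
    fix x assume ne: "P x \<noteq> Q x"
    obtain n where n: "dist x (d n) < dist (P x) (Q x) / 2" using near ne by (metis half_gt_zero zero_less_dist_iff)
    have "dist (P x) (Q x) \<le> dist (P x) (P (d n)) + dist (Q x) (Q (d n))"
      using that(1)[of n] by metric
    then show False using n that(2,3)[of x "d n"] by simp
  qed
  have C: "\<phi> ` carrier Isom = C"
  proof
    show "\<phi> ` carrier Isom \<subseteq> C"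
    proof (rule image_subsetI)
      fix g :: "'a \<Rightarrow> 'a" assume g: "g \<in> carrier Isom"
      have "dist (g (d m)) (d n) = dist (d m) (inv_into UNIV g (d n))" for m n
        using Isom_dist [OF g, of "d m" "inv_into UNIV g (d n)"] g by (simp add: Isom_inv_into)
      then show "\<phi> g \<in> C"
        using g Isom_dist [OF Isom_inv_into(1) [OF g]] by (auto simp: C_def \<phi>_def Isom_dist Isom_inv)
    qed
    show "C \<subseteq> \<phi> ` carrier Isom"
    proof clarify
      fix p q assume pq: "(p, q) \<in> C"
      obtain P where P: "\<And>n. P (d n) = p n" "\<And>x y. dist (P x) (P y) = dist x y"
        using isometry_extension [OF d, of p] pq by (auto simp: C_def)
      obtain Q where Q: "\<And>n. Q (d n) = q n" "\<And>x y. dist (Q x) (Q y) = dist x y"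
        using isometry_extension [OF d, of q] pq by (auto simp: C_def)
      have c: "continuous_on UNIV P" "continuous_on UNIV Q"
        using P(2) Q(2) by (auto simp: continuous_on_iff)
      have cl: "closure (range d \<times> range d) \<subseteq> {z. dist (P (fst z)) (snd z) = dist (fst z) (Q (snd z))}"
      proof (rule closure_minimal)
        show "closed {z. dist (P (fst z)) (snd z) = dist (fst z) (Q (snd z))}"
          by (intro closed_Collect_eq continuous_intros continuous_on_compose2 [OF c(1)]
              continuous_on_compose2 [OF c(2)]) auto
      qed (use pq P Q in \<open>auto simp: C_def\<close>)
      then have adj: "dist (P x) y = dist x (Q y)" for x y
        using subsetD [OF cl, of "(x, y)"] by (simp add: closure_Times d)
      \<comment> \<open>Both instances make one side of \<open>adj\<close> the distance of a point
        to itself, hence 0.\<close>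
      have PQ: "P (Q y) = y" "Q (P y) = y" for y
        using adj [of "Q y" y] adj [of y "P y"] by simp_all
      then have "bij P" by (metis bijI')
      then have "P \<in> carrier Isom" using P by (simp add: Isom_carrier)
      moreover have "inv_into UNIV P = Q" using PQ by (metis inv_equality)
      ultimately have "\<phi> P = (p, q)" using P Q by (auto simp: \<phi>_def Isom_inv)
      then show "(p, q) \<in> \<phi> ` carrier Isom" using \<open>P \<in> carrier Isom\<close> by (intro image_eqI [where x = P]) simp_all
    qed
  qed
  have inj: "inj_on \<phi> (carrier Isom)"
  proof (rule inj_onI)
    fix g h assume gh: "g \<in> carrier Isom" "h \<in> carrier Isom" "\<phi> g = \<phi> h"
    then have "g (d n) = h (d n)" for n by (simp add: \<phi>_def fun_eq_iff)
    then show "g = h" using gh by (intro ext_eq) (simp_all add: Isom_dist)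
  qed
  let ?X = "prod_topology (product_topology (\<lambda>_. euclidean) UNIV) (product_topology (\<lambda>_. euclidean) UNIV)
    :: ((nat \<Rightarrow> 'a) \<times> (nat \<Rightarrow> 'a)) topology"
  have X: "?X = euclidean"
    by (simp add: euclidean_product_topology)
  \<comment> \<open>Countability of the index set is what makes the product completely metrizable;
    this is why \<open>\<phi>\<close> records values only along a sequence.\<close>
  have "completely_metrizable_space ?X"
    by (simp add: completely_metrizable_space_prod_topology completely_metrizable_space_product_topology
        completely_metrizable_space_euclidean)
  moreover have "closed C"
    unfolding C_def
    by (intro closed_Collect_conj closed_Collect_all closed_Collect_eq continuous_intros
        continuous_on_product_then_coordinatewise)
  ultimately have cm: "completely_metrizable_space (top_of_set C)"
    unfolding X by (simp add: completely_metrizable_space_closedin)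
  have "homeomorphic_maps (pointwise_topology :: ('a \<Rightarrow> 'a) topology) (top_of_set C) \<phi> (inv_into (carrier Isom) \<phi>)"
    unfolding homeomorphic_maps_def
  proof (intro conjI)
    have "continuous_map pointwise_topology ?X \<phi>"
      unfolding \<phi>_def continuous_map_paired continuous_map_componentwise_UNIV
    proof (intro conjI allI)
      have "continuous_map pointwise_topology pointwise_topology (\<lambda>x. x :: 'a \<Rightarrow> 'a)" by simp
      then show "continuous_map pointwise_topology euclidean (\<lambda>g. g (d k))" for k
        unfolding continuous_map_into_pointwise_topology by blast
      have "continuous_map pointwise_topology pointwise_topology (\<lambda>g. inv\<^bsub>Isom\<^esub> g :: 'a \<Rightarrow> 'a)"
        using group_topology_pointwise [where 'a = 'a] by (simp add: group_topology_def)
      then show "continuous_map pointwise_topology euclidean (\<lambda>g. (inv\<^bsub>Isom\<^esub> g) (d k))" for k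
        unfolding continuous_map_into_pointwise_topology by blast
    qed
    then show "continuous_map pointwise_topology (top_of_set C) \<phi>"
      using C X by (auto simp: continuous_map_in_subtopology)
    show "continuous_map (top_of_set C) pointwise_topology (inv_into (carrier Isom) \<phi>)"
      unfolding continuous_map_into_pointwise_topology continuous_map_euclidean_metric
    proof (intro conjI allI ballI impI)
      fix x :: 'a and z and e :: real assume z: "z \<in> topspace (top_of_set C)" and e: "e > 0"
      obtain g where g: "g \<in> carrier Isom" "z = \<phi> g" using z C by auto
      obtain n where n: "dist x (d n) < e/3" using near e by (metis divide_pos_pos zero_less_numeral)
      \<comment> \<open>One value of the first component suffices: \<open>x\<close> is within
        \<open>e/3\<close> of \<open>d n\<close>, and both isometries preserve that
        distance.\<close>
      let ?U = "C \<inter> {w. dist (fst w n) (fst z n) < e/3}"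
      have "open {w. dist (fst w n) (fst z n) < e/3}"
        by (intro open_Collect_less continuous_intros continuous_on_product_then_coordinatewise)
      then have U: "openin (top_of_set C) ?U" by blast
      have "dist (inv_into (carrier Isom) \<phi> w x) (inv_into (carrier Isom) \<phi> z x) < e" if w: "w \<in> ?U" for w
      proof -
        obtain h where h: "h \<in> carrier Isom" "w = \<phi> h" using w C by auto
        have "dist (h (d n)) (g (d n)) < e/3" using w h g by (simp add: \<phi>_def)
        moreover have "dist (h x) (g x) \<le> dist (h x) (h (d n)) + dist (h (d n)) (g (d n)) + dist (g x) (g (d n))"
          by metric
        ultimately have "dist (h x) (g x) < e" using n h g by (simp add: Isom_dist)
        then show ?thesis using g h inj by simp
      qed
      then show "\<exists>U. openin (top_of_set C) U \<and> z \<in> U \<and>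
          (\<forall>y\<in>U. dist (inv_into (carrier Isom) \<phi> y x) (inv_into (carrier Isom) \<phi> z x) < e)"
        using U z e by (intro exI [of _ ?U]) auto
    qed (use C in \<open>auto simp: inv_into_into\<close>)
  qed (use C inj in \<open>auto simp: f_inv_into_f\<close>)
  then have "(pointwise_topology :: ('a \<Rightarrow> 'a) topology) homeomorphic_space top_of_set C"
    by (auto simp: homeomorphic_space_def)
  then show ?thesis using cm homeomorphic_completely_metrizable_space by blast
qed

lemma Polish_group_Isom:
  assumes "separable_space (euclidean :: 'a::complete_space topology)"
  shows "Polish_group (Isom :: ('a \<Rightarrow> 'a) monoid) pointwise_topology"
proof -
  obtain D :: "'a set" where D: "countable D" "closure D = UNIV"
    using assms by (auto simp: separable_space_def)
  have "D \<noteq> {}" using D(2) by auto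
  then have "closure (range (from_nat_into D)) = UNIV" using D by (simp add: range_from_nat_into)
  then show ?thesis
    unfolding Polish_group_def
    using group_topology_pointwise second_countable_pointwise completely_metrizable_pointwise by blast
qed

section \<open>Rotations, translations and the point reflection\<close>

lemma translation_in_Isom: "(+) v \<in> carrier (Isom :: ('a::real_normed_vector \<Rightarrow> 'a) monoid)"
  by (simp add: Isom_carrier bij_plus_right)

lemma uminus_in_Isom: "uminus \<in> carrier (Isom :: ('a::real_normed_vector \<Rightarrow> 'a) monoid)"
proof -
  have "bij (uminus :: 'a \<Rightarrow> 'a)" by (metis bijI' minus_minus)
  then show ?thesis by (simp add: Isom_carrier dist_minus)
qed

lemma Isom_inv_eqI:
  assumes "g \<in> carrier Isom" "\<And>x. g (h x) = x"
  shows "inv\<^bsub>Isom\<^esub> g = h"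
  using assms by (metis Isom_inv Isom_inv_into(3) ext)

lemma Isom_inv_translation [simp]:
  "inv\<^bsub>Isom\<^esub> ((+) v) = (+) (- v :: 'a::real_normed_vector)"
  by (rule Isom_inv_eqI [OF translation_in_Isom]) simp

lemma Isom_pow_translation:
  "(+) v [^]\<^bsub>Isom\<^esub> (n::nat) = (+) (real n *\<^sub>R v :: 'a::real_normed_vector)"
proof (induction n)
  case (Suc n)
  then show ?case
    using monoid.nat_pow_Suc [OF group.is_monoid [OF group_Isom]]
    by (auto simp: fun_eq_iff algebra_simps)
qed (auto simp: fun_eq_iff monoid.nat_pow_0 [OF group.is_monoid [OF group_Isom]])

text \<open>The parallelogram law gives \<open>g y + g (- y) = 2 g 0\<close>.\<close>

lemma commutator_reflection:
  fixes g :: "'a::real_inner \<Rightarrow> 'a"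
  assumes g: "g \<in> carrier Isom"
  shows "g \<otimes>\<^bsub>Isom\<^esub> uminus \<otimes>\<^bsub>Isom\<^esub> inv\<^bsub>Isom\<^esub> g \<otimes>\<^bsub>Isom\<^esub> uminus = (+) (2 *\<^sub>R g 0)"
proof -
  have sym: "g (- y) = 2 *\<^sub>R g 0 - g y" for y
  proof -
    let ?p = "g y - g 0" and ?q = "g (- y) - g 0"
    have d: "norm (g a - g b) = norm (a - b)" for a b
      using Isom_dist [OF g] by (simp add: dist_norm)
    have p: "norm ?p = norm y" and q: "norm ?q = norm y" by (simp_all add: d)
    have "norm (?p - ?q) = norm (y + y)" by (simp add: d)
    \<comment> \<open>Two vectors of norm \<open>norm y\<close> whose difference has norm
      \<open>2 * norm y\<close> must be opposite; the next identity makes this precise.\<close>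
    then have pq: "norm (?p - ?q) = 2 * norm y" by (simp flip: scaleR_2)
    have "(norm (?p + ?q))\<^sup>2 = 2 * (norm ?p)\<^sup>2 + 2 * (norm ?q)\<^sup>2 - (norm (?p - ?q))\<^sup>2"
      unfolding power2_norm_eq_inner by (simp only: inner_add_left inner_add_right inner_diff_left inner_diff_right) simp
    then have "?p + ?q = 0" unfolding p q pq by (simp add: power2_eq_square)
    then show ?thesis by (simp add: scaleR_2 algebra_simps)
  qed
  \<comment> \<open>With \<open>y\<close> the preimage of \<open>- x\<close> under \<open>g\<close>,
    the commutator sends \<open>x\<close> to
    \<open>g (- y) = 2 g 0 - g y = 2 g 0 + x\<close>.\<close>
  show ?thesis
    using g by (auto simp: fun_eq_iff Isom_inv sym Isom_inv_into)
qed

text \<open>For orthonormal \<open>a\<close>, \<open>b\<close> this is the rotation of their plane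
  with sine \<open>s\<close> and nonnegative cosine, fixing the orthogonal complement. Parametrising
  by the sine makes \<open>- s\<close> give the inverse.\<close>

definition rotation :: "'a::real_inner \<Rightarrow> 'a \<Rightarrow> real \<Rightarrow> 'a \<Rightarrow> 'a" where
  "rotation a b s x = x
     + ((sqrt (1 - s\<^sup>2) - 1) * (x \<bullet> a) - s * (x \<bullet> b)) *\<^sub>R a
     + (s * (x \<bullet> a) + (sqrt (1 - s\<^sup>2) - 1) * (x \<bullet> b)) *\<^sub>R b"

context
  fixes a b :: "'a::real_inner" and s :: real
  assumes orthonormal: "a \<bullet> a = 1" "b \<bullet> b = 1" "a \<bullet> b = 0" and s: "\<bar>s\<bar> \<le> 1"
begin

private lemma cos_sin: "(sqrt (1 - s\<^sup>2))\<^sup>2 = 1 - s\<^sup>2"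
  using s by (simp add: abs_square_le_1)

lemma rotation_minus_rotation: "rotation a b s (rotation a b (- s) x) = x"
proof -
  define c where "c = sqrt (1 - s\<^sup>2)"
  have c: "c * c = 1 - s * s" using cos_sin by (simp add: c_def power2_eq_square)
  define p where "p = (c - 1) * (x \<bullet> a) + s * (x \<bullet> b)"
  define q where "q = - s * (x \<bullet> a) + (c - 1) * (x \<bullet> b)"
  have y: "rotation a b (- s) x = x + p *\<^sub>R a + q *\<^sub>R b"
    by (simp add: rotation_def p_def q_def c_def)
  have ya: "(x + p *\<^sub>R a + q *\<^sub>R b) \<bullet> a = x \<bullet> a + p" and yb: "(x + p *\<^sub>R a + q *\<^sub>R b) \<bullet> b = x \<bullet> b + q"
    using orthonormal by (simp_all add: inner_add_left inner_commute [of b a])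
  \<comment> \<open>Both identities say that the second rotation undoes the displacement
    \<open>p a + q b\<close> of the first; they reduce to \<open>c * c + s * s = 1\<close>.\<close>
  have p0: "(c - 1) * (x \<bullet> a + p) - s * (x \<bullet> b + q) = - p"
    unfolding p_def q_def using c by algebra
  have q0: "s * (x \<bullet> a + p) + (c - 1) * (x \<bullet> b + q) = - q"
    unfolding p_def q_def using c by algebra
  show ?thesis
    unfolding y rotation_def [of a b s] ya yb c_def [symmetric] p0 q0 by simp
qed

lemma norm_rotation: "norm (rotation a b s x) = norm x"
proof -
  define c where "c = sqrt (1 - s\<^sup>2)"
  have c: "c * c = 1 - s * s" using cos_sin by (simp add: c_def power2_eq_square)
  define p where "p = (c - 1) * (x \<bullet> a) - s * (x \<bullet> b)"
  define q where "q = s * (x \<bullet> a) + (c - 1) * (x \<bullet> b)"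
  have "(norm (rotation a b s x))\<^sup>2 = (norm x)\<^sup>2 + (2 * p * (x \<bullet> a) + 2 * q * (x \<bullet> b) + p * p + q * q)"
    unfolding rotation_def power2_norm_eq_inner c_def [symmetric] p_def [symmetric] q_def [symmetric]
    using orthonormal
    by (simp add: inner_add_left inner_add_right inner_commute [of b a] inner_commute [of a x]
        inner_commute [of b x] algebra_simps)
  also have "2 * p * (x \<bullet> a) + 2 * q * (x \<bullet> b) + p * p + q * q = 0"
    unfolding p_def q_def using c by algebra
  finally show ?thesis by simp
qed

text \<open>The displacement has four coefficient terms, each at most
  \<open>\<bar>s\<bar> * norm x\<close>. The bound is uniform in the plane, so the plane can be
  chosen after the angle bound is fixed.\<close>

lemma norm_rotation_diff: "norm (rotation a b s x - x) \<le> 4 * \<bar>s\<bar> * norm x"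
proof -
  define c where "c = sqrt (1 - s\<^sup>2)"
  have c: "c * c = 1 - s * s" "c \<ge> 0" using cos_sin s by (simp_all add: c_def power2_eq_square abs_square_le_1)
  have c1: "c \<le> 1" by (simp add: c_def)
  have "c * c \<le> c" using c(2) c1 by (rule mult_left_le [rotated])
  moreover have "s * s \<le> \<bar>s\<bar>" using s by (metis abs_ge_zero abs_mult_self_eq mult_left_le)
  \<comment> \<open>Indeed \<open>1 - c \<le> 1 - c * c = s * s \<le> \<bar>s\<bar>\<close>.\<close>
  ultimately have cs: "\<bar>c - 1\<bar> \<le> \<bar>s\<bar>" using c c1 by linarith
  have n: "norm a = 1" "norm b = 1" using orthonormal by (simp_all add: norm_eq_1)
  have xa: "\<bar>x \<bullet> a\<bar> \<le> norm x" and xb: "\<bar>x \<bullet> b\<bar> \<le> norm x"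
    using Cauchy_Schwarz_ineq2 [of x a] Cauchy_Schwarz_ineq2 [of x b] n by simp_all
  have m: "\<bar>t * z\<bar> \<le> \<bar>s\<bar> * norm x" if "\<bar>t\<bar> \<le> \<bar>s\<bar>" "\<bar>z\<bar> \<le> norm x" for t z
    using that by (simp add: abs_mult mult_mono)
  have "norm (rotation a b s x - x) \<le>
      norm (((c - 1) * (x \<bullet> a) - s * (x \<bullet> b)) *\<^sub>R a) + norm ((s * (x \<bullet> a) + (c - 1) * (x \<bullet> b)) *\<^sub>R b)"
    unfolding rotation_def c_def [symmetric] by (metis add.assoc add_diff_cancel_left' norm_triangle_ineq)
  also have "\<dots> = \<bar>(c - 1) * (x \<bullet> a) - s * (x \<bullet> b)\<bar> + \<bar>s * (x \<bullet> a) + (c - 1) * (x \<bullet> b)\<bar>"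
    using n by simp
  also have "\<dots> \<le> 4 * (\<bar>s\<bar> * norm x)"
    using m [OF cs xa] m [OF cs xb] m [OF order.refl xa] m [OF order.refl xb] by linarith
  finally show ?thesis by simp
qed

lemma rotation_diff: "rotation a b s (x - y) = rotation a b s x - rotation a b s y"
  by (simp add: rotation_def inner_diff_left algebra_simps)

end

lemma rotation_in_Isom:
  assumes "a \<bullet> a = 1" "b \<bullet> b = 1" "a \<bullet> b = 0" "\<bar>s\<bar> \<le> 1"
  shows "rotation a b s \<in> carrier Isom"
    and "inv\<^bsub>Isom\<^esub> (rotation a b s) = rotation a b (- s)"
proof -
  have 1: "rotation a b s (rotation a b (- s) x) = x" "rotation a b (- s) (rotation a b s x) = x" for x
    using rotation_minus_rotation [of a b s x] rotation_minus_rotation [of a b "- s" x] assms by simp_all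
  then have "bij (rotation a b s)" by (metis bijI')
  then show "rotation a b s \<in> carrier Isom"
    using assms by (simp add: Isom_carrier dist_norm norm_rotation flip: rotation_diff)
  then show "inv\<^bsub>Isom\<^esub> (rotation a b s) = rotation a b (- s)"
    using 1 by (intro Isom_inv_eqI)
qed

text \<open>The conjugate of \<open>t\<close> by \<open>r\<close> times the conjugate of
  \<open>t^-1\<close> by \<open>r^-1\<close>. Unlike the commutator, which would translate by
  \<open>r v - v\<close>, this symmetric form cancels the cosine parts and leaves no component along
  \<open>v\<close>.\<close>

definition rotation_word :: "('a::real_inner \<Rightarrow> 'a) \<Rightarrow> ('a \<Rightarrow> 'a) \<Rightarrow> 'a \<Rightarrow> 'a" where
  "rotation_word r t = r \<otimes>\<^bsub>Isom\<^esub> t \<otimes>\<^bsub>Isom\<^esub> inv\<^bsub>Isom\<^esub> r \<otimes>\<^bsub>Isom\<^esub> inv\<^bsub>Isom\<^esub> r \<otimes>\<^bsub>Isom\<^esub> inv\<^bsub>Isom\<^esub> t \<otimes>\<^bsub>Isom\<^esub> r"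

text \<open>If \<open>r\<close> is the rotation by a small angle in the plane of \<open>v\<close> and \<open>u\<close>, the word is the
  translation by \<open>r v - r\<^sup>-\<^sup>1 v\<close>, a multiple of \<open>u\<close> that is as long as we like when \<open>v\<close> is long.\<close>

lemma translation_as_rotation_word:
  fixes u v :: "'a::real_inner"
  assumes uv: "u \<bullet> v = 0" "u \<noteq> 0" "v \<noteq> 0" and le: "norm u \<le> 2 * \<eta> * norm v" and \<eta>: "\<eta> \<le> 1"
  obtains r where "r \<in> carrier Isom" "\<And>x. norm (r x - x) \<le> 4 * \<eta> * norm x"
    "rotation_word r ((+) v) = (+) u"
proof -
  define a where "a = v /\<^sub>R norm v"
  define b where "b = u /\<^sub>R norm u"
  \<comment> \<open>Since \<open>r v - r^-1 v\<close> equals \<open>2 * s * norm v\<close> times the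
    unit vector \<open>b\<close>, this sine produces exactly \<open>u\<close>.\<close>
  define s where "s = norm u / (2 * norm v)"
  have "norm a = 1" "norm b = 1" using uv by (simp_all add: a_def b_def)
  then have o: "a \<bullet> a = 1" "b \<bullet> b = 1" "a \<bullet> b = 0"
    using uv by (simp_all add: norm_eq_1) (simp add: a_def b_def inner_commute [of v u])
  have s: "0 \<le> s" "s \<le> \<eta>" using le uv(3) by (simp_all add: s_def divide_simps mult_ac)
  then have s1: "\<bar>s\<bar> \<le> 1" using \<eta> by simp
  define r where "r = rotation a b s"
  have r: "r \<in> carrier Isom" "inv\<^bsub>Isom\<^esub> r = rotation a b (- s)"
    using rotation_in_Isom [OF o s1] by (simp_all add: r_def)
  have "norm (r x - x) \<le> 4 * \<eta> * norm x" for x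
    using norm_rotation_diff [OF o s1, of x] s
    by (simp add: r_def) (meson mult_left_mono mult_right_mono norm_ge_zero order_trans zero_le_numeral)
  moreover have "rotation_word r ((+) v) = (+) u"
  proof
    fix x
    let ?m = "rotation a b (- s)"
    have rm: "r (?m y) = y" "?m (r y) = y" for y
      using rotation_minus_rotation [of a b s y] rotation_minus_rotation [of a b "- s" y] o s1
      by (simp_all add: r_def)
    have ld: "r (y - z) = r y - r z" for y z by (simp add: r_def rotation_diff [OF o s1])
    have md: "?m (y - z) = ?m y - ?m z" for y z using rotation_diff [of a b "- s"] o s1 by simp
    have va: "v \<bullet> a = norm v" "v \<bullet> b = 0"
      using uv by (simp_all add: a_def b_def inner_commute [of v u] dot_square_norm power2_eq_square)
    have "r v - ?m v = (2 * s * norm v) *\<^sub>R b"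
      by (simp add: r_def rotation_def va algebra_simps) (simp flip: scaleR_add_left)
    also have "\<dots> = u" using uv by (simp add: s_def b_def)
    finally have u: "r v - ?m v = u" .
    have "rotation_word r ((+) v) x = r (v + ?m (?m (- v + r x)))"
      by (simp add: rotation_word_def r)
    also have "?m (- v + r x) = x - ?m v" using md [of "r x" v] rm by simp
    also have "r (v + ?m (x - ?m v)) = r (v - ?m (?m v - x))" by (simp add: md algebra_simps)
    also have "\<dots> = r v - (?m v - x)" by (simp only: ld rm)
    also have "\<dots> = u + x" using u by (simp add: algebra_simps)
    finally show "rotation_word r ((+) v) x = u + x" .
  qed
  ultimately show ?thesis using that r(1) by blast
qed

text \<open>Subtract from a vector outside the span of \<open>F\<close> its orthogonal projection
  onto that span.\<close>

lemma infinite_dimensional_orthogonal: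
  fixes F :: "'a::real_inner set"
  assumes "infinite_dimensional TYPE('a)" "finite F"
  obtains u :: 'a where "u \<noteq> 0" "\<And>x. x \<in> F \<Longrightarrow> u \<bullet> x = 0"
proof -
  obtain C where C: "finite C" "span C = span F" "pairwise orthogonal C"
    using basis_orthogonal [OF assms(2)] by blast
  obtain y where y: "y \<notin> span C" using assms C(1) by (auto simp: infinite_dimensional_def)
  define u where "u = y - (\<Sum>b\<in>C. (b \<bullet> y / (b \<bullet> b)) *\<^sub>R b)"
  have "(\<Sum>b\<in>C. (b \<bullet> y / (b \<bullet> b)) *\<^sub>R b) \<in> span C"
    by (intro span_sum span_scale span_base)
  then have "u \<noteq> 0" using y by (auto simp: u_def)
  moreover have "u \<bullet> x = 0" if "x \<in> F" for x
  proof -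
    have "u \<bullet> c = 0" if c: "c \<in> C" for c
    proof -
      \<comment> \<open>If \<open>c = 0\<close>, the quotient is 0 by the convention for division by
        zero, and \<open>c \<bullet> y\<close> is 0 as well.\<close>
      have "(\<Sum>b\<in>C. (b \<bullet> y / (b \<bullet> b)) *\<^sub>R b) \<bullet> c = (\<Sum>b\<in>C. if b = c then c \<bullet> y else 0)"
        unfolding inner_sum_left using C(3) c
        by (intro sum.cong) (auto simp: pairwise_def orthogonal_def)
      then show ?thesis using C(1) c by (simp add: u_def inner_diff_left inner_commute [of y c])
    qed
    then have "C \<subseteq> {z. u \<bullet> z = 0}" by blast
    then have "span C \<subseteq> {z. u \<bullet> z = 0}" by (rule span_minimal) (simp add: subspace_hyperplane)
    moreover have "x \<in> span C" using that C(2) by (simp add: span_base)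
    ultimately show ?thesis by blast
  qed
  ultimately show ?thesis using that by blast
qed

section \<open>Coarser group topologies\<close>

lemma group_topology_mult:
  assumes "group_topology G S" "continuous_map X S f" "continuous_map X S g"
  shows "continuous_map X S (\<lambda>x. f x \<otimes>\<^bsub>G\<^esub> g x)"
proof -
  have "continuous_map X S ((\<lambda>(x, y). x \<otimes>\<^bsub>G\<^esub> y) \<circ> (\<lambda>x. (f x, g x)))"
    using assms by (intro continuous_map_compose [where X' = "prod_topology S S"])
      (auto simp: continuous_map_paired group_topology_def)
  then show ?thesis by (simp add: o_def)
qed

lemma group_topology_inv:
  assumes "group_topology G S" "continuous_map X S f"
  shows "continuous_map X S (\<lambda>x. inv\<^bsub>G\<^esub> (f x))"
  using continuous_map_compose [OF assms(2), of S "\<lambda>x. inv\<^bsub>G\<^esub> x"] assms(1)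
  by (simp add: o_def group_topology_def)

lemma group_topology_pow:
  assumes "group_topology G S" "continuous_map X S f"
  shows "continuous_map X S (\<lambda>x. f x [^]\<^bsub>G\<^esub> (n::nat))"
proof -
  interpret group G using assms(1) by (simp add: group_topology_def)
  show ?thesis
  proof (induction n)
    case 0
    then show ?case using assms(1) by (simp add: group_topology_def)
  qed (simp add: group_topology_mult [OF assms(1)] assms(2))
qed

context
  fixes S :: "('a::real_inner \<Rightarrow> 'a) topology"
  assumes S: "group_topology Isom S"
    and coarser: "\<And>U. openin S U \<Longrightarrow> openin pointwise_topology U"
begin

private lemma topspace_S [simp]: "topspace S = carrier Isom"
  using S by (simp add: group_topology_def)

text \<open>Continuity of the word at \<open>(id, id)\<close>, where its value is \<open>id\<close>;
  intersecting the two factors of a product neighbourhood gives a single \<open>U\<close>.\<close>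

private lemma neighbourhood_rotation_word:
  assumes "openin S W" "id \<in> W"
  obtains U where "openin S U" "id \<in> U" "\<And>r t. r \<in> U \<Longrightarrow> t \<in> U \<Longrightarrow> rotation_word r t \<in> W"
proof -
  let ?f = "\<lambda>p. rotation_word (fst p) (snd p)"
  let ?P = "{p \<in> topspace (prod_topology S S). ?f p \<in> W}"
  have "continuous_map (prod_topology S S) S ?f"
    unfolding rotation_word_def
    by (intro group_topology_mult [OF S] group_topology_inv [OF S] continuous_map_fst continuous_map_snd)
  then have op: "openin (prod_topology S S) ?P"
    using assms(1) by (rule openin_continuous_map_preimage)
  have "inv\<^bsub>Isom\<^esub> id = (id :: 'a \<Rightarrow> 'a)"
    using group.is_monoid [OF group_Isom, THEN monoid.inv_one] by simp
  then have "rotation_word id id = (id :: 'a \<Rightarrow> 'a)" by (simp add: rotation_word_def)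
  moreover have "id \<in> carrier (Isom :: ('a \<Rightarrow> 'a) monoid)"
    by (simp add: Isom_carrier)
  ultimately have idP: "(id, id) \<in> ?P" using assms by simp
  then obtain U V where "openin S U" "openin S V" "id \<in> U" "id \<in> V" "U \<times> V \<subseteq> ?P"
    using op [unfolded openin_prod_topology_alt, rule_format, OF idP] by blast
  then show ?thesis by (intro that [of "U \<inter> V"]) (auto dest: subsetD)
qed

text \<open>Because \<open>S\<close> is coarser, \<open>U\<close> contains a basic pointwise
  neighbourhood, which tests only finitely many points. These are bounded, so a displacement small
  relative to the norm is small on all of them.\<close>

private lemma neighbourhood_near_identity:
  assumes "openin S U" "id \<in> U"
  obtains \<eta> where "0 < \<eta>" "\<eta> \<le> 1"
    "\<And>r. r \<in> carrier Isom \<Longrightarrow> (\<And>x. norm (r x - x) \<le> 4 * \<eta> * norm x) \<Longrightarrow> r \<in> U"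
proof -
  obtain X e where X: "finite X" "e > 0"
      "\<And>h. h \<in> carrier Isom \<Longrightarrow> (\<And>x. x \<in> X \<Longrightarrow> dist (h x) (id x) < e) \<Longrightarrow> h \<in> U"
    using pointwise_topology_neighbourhood [OF coarser [OF assms(1)] assms(2)] by metis
  define M where "M = Max (insert 1 (norm ` X))"
  have M: "M \<ge> 1" "\<And>x. x \<in> X \<Longrightarrow> norm x \<le> M" using X(1) by (simp_all add: M_def)
  \<comment> \<open>On vectors of norm at most \<open>M\<close> the displacement is then at most
    \<open>e / 2\<close>; the cap 1 keeps \<eta> admissible as a bound on sines.\<close>
  define \<eta> where "\<eta> = min 1 (e / (8 * M))"
  have \<eta>: "0 < \<eta>" "\<eta> \<le> 1" "\<eta> \<le> e / (8 * M)" using X(2) M(1) by (simp_all add: \<eta>_def)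
  show ?thesis
  proof (rule that [OF \<eta>(1,2)])
    fix r :: "'a \<Rightarrow> 'a"
    assume r: "r \<in> carrier Isom" "\<And>x. norm (r x - x) \<le> 4 * \<eta> * norm x"
    have "dist (r x) (id x) < e" if "x \<in> X" for x
    proof -
      have "dist (r x) (id x) \<le> 4 * \<eta> * norm x" using r(2) by (simp add: dist_norm)
      also have "\<dots> \<le> 4 * (e / (8 * M)) * M" using \<eta> M that X(2) by (intro mult_mono) auto
      also have "\<dots> < e" using M(1) X(2) by simp
      finally show ?thesis .
    qed
    then show "r \<in> U" using X(3) r(1) by blast
  qed
qed

text \<open>A long \<open>v\<close> yields a long \<open>u\<close> orthogonal to \<open>v\<close> and \<open>e\<close>, and \<open>u\<close> in turn yields \<open>e\<close>.\<close>

private lemma unbounded_translations_not_separated: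
  assumes inf: "infinite_dimensional TYPE('a)"
    and unb: "\<And>U R. openin S U \<Longrightarrow> id \<in> U \<Longrightarrow> \<exists>v. (+) v \<in> U \<and> norm v > R"
    and W: "openin S W" "id \<in> W" and e: "e \<noteq> 0"
  shows "(+) e \<in> W"
proof -
  \<comment> \<open>The word is applied twice, from \<open>v\<close> to \<open>u\<close> and from
    \<open>u\<close> to \<open>e\<close>, so neighbourhoods are pulled back twice, starting from the
    target \<open>W\<close>.\<close>
  obtain U where U: "openin S U" "id \<in> U" "\<And>r t. r \<in> U \<Longrightarrow> t \<in> U \<Longrightarrow> rotation_word r t \<in> W"
    using neighbourhood_rotation_word [OF W] by metis
  obtain \<eta> where \<eta>: "0 < \<eta>" "\<eta> \<le> 1"
    "\<And>r. r \<in> carrier Isom \<Longrightarrow> (\<And>x. norm (r x - x) \<le> 4 * \<eta> * norm x) \<Longrightarrow> r \<in> U"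
    using neighbourhood_near_identity [OF U(1,2)] by metis
  obtain U' where U': "openin S U'" "id \<in> U'" "\<And>r t. r \<in> U' \<Longrightarrow> t \<in> U' \<Longrightarrow> rotation_word r t \<in> U"
    using neighbourhood_rotation_word [OF U(1,2)] by metis
  obtain \<theta> where \<theta>: "0 < \<theta>" "\<theta> \<le> 1"
    "\<And>r. r \<in> carrier Isom \<Longrightarrow> (\<And>x. norm (r x - x) \<le> 4 * \<theta> * norm x) \<Longrightarrow> r \<in> U'"
    using neighbourhood_near_identity [OF U'(1,2)] by metis
  \<comment> \<open>The least length of \<open>u\<close> from which a rotation with sine at most
    \<eta> reaches \<open>e\<close>.\<close>
  define R where "R = norm e / (2 * \<eta>)"
  have R: "R > 0" "norm e \<le> 2 * \<eta> * R" using e \<eta> by (simp_all add: R_def)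
  obtain v where v: "(+) v \<in> U'" "norm v > R / (2 * \<theta>)" using unb [OF U'(1,2)] by blast
  have v0: "R \<le> 2 * \<theta> * norm v" "v \<noteq> 0"
    using v(2) R(1) \<theta>(1) by (auto simp: field_simps)
  \<comment> \<open>Each word needs its source and target orthogonal, but the direction of
    \<open>v\<close> is not under control; hence an intermediate direction orthogonal to both
    \<open>v\<close> and \<open>e\<close>.\<close>
  obtain w where w: "w \<noteq> 0" "\<And>x. x \<in> {v, e} \<Longrightarrow> w \<bullet> x = 0"
    using infinite_dimensional_orthogonal [OF inf, of "{v, e}"] by auto
  define u where "u = (R / norm w) *\<^sub>R w"
  have u: "norm u = R" "u \<noteq> 0" "u \<bullet> v = 0" "e \<bullet> u = 0"
    using w R(1) by (auto simp: u_def inner_commute)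
  obtain r where "r \<in> carrier Isom" "\<And>x. norm (r x - x) \<le> 4 * \<theta> * norm x"
      "rotation_word r ((+) v) = (+) u"
    using translation_as_rotation_word [of u v \<theta>] u v0 \<theta>(2) by auto
  then have uU: "(+) u \<in> U" using U'(3) [of r "(+) v"] \<theta>(3) v(1) by auto
  obtain r where "r \<in> carrier Isom" "\<And>x. norm (r x - x) \<le> 4 * \<eta> * norm x"
      "rotation_word r ((+) u) = (+) e"
    using translation_as_rotation_word [of e u \<eta>] u R(2) e \<eta>(2) by auto
  then show ?thesis using U(3) [of r "(+) u"] \<eta>(3) uU by auto
qed

text \<open>Taking powers amplifies: if the translation by \<open>2 n g 0\<close> lies in
  \<open>W\<close>, then \<open>norm (g 0)\<close> is at most \<open>R / (2 n)\<close>, which is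
  below \<open>e\<close> for \<open>n\<close> large.\<close>

private lemma bounded_translations_orbit_continuous:
  assumes W: "openin S W" "id \<in> W" and bdd: "\<And>v. (+) v \<in> W \<Longrightarrow> norm v \<le> R"
    and e: "e > 0"
  obtains U where "openin S U" "id \<in> U" "\<And>g. g \<in> U \<Longrightarrow> norm (g 0) < e"
proof -
  obtain n where n: "R / (2 * e) < real n" using reals_Archimedean2 by blast
  let ?f = "\<lambda>g. (g \<otimes>\<^bsub>Isom\<^esub> uminus \<otimes>\<^bsub>Isom\<^esub> inv\<^bsub>Isom\<^esub> g \<otimes>\<^bsub>Isom\<^esub> uminus) [^]\<^bsub>Isom\<^esub> n"
  have f: "?f g = (+) (real n *\<^sub>R 2 *\<^sub>R g 0)" if "g \<in> carrier Isom" for g :: "'a \<Rightarrow> 'a"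
    using commutator_reflection [OF that] by (simp only: Isom_pow_translation)
  have "continuous_map S S ?f"
    by (intro group_topology_pow [OF S] group_topology_mult [OF S] group_topology_inv [OF S])
      (auto simp: uminus_in_Isom)
  then have op: "openin S {g \<in> topspace S. ?f g \<in> W}"
    using W(1) by (rule openin_continuous_map_preimage)
  have idI: "id \<in> carrier (Isom :: ('a \<Rightarrow> 'a) monoid)"
    by (simp add: Isom_carrier)
  have "(+) (0::'a) = id" by (auto simp: fun_eq_iff)
  then have "?f id = (id :: 'a \<Rightarrow> 'a)" using f [OF idI] by (simp only: id_apply scaleR_zero_right)
  then have "id \<in> {g \<in> topspace S. ?f g \<in> W}" using idI W(2) by simp
  moreover have "norm (g 0) < e" if g: "g \<in> {g \<in> topspace S. ?f g \<in> W}" for g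
  proof -
    have "norm (real n *\<^sub>R 2 *\<^sub>R g 0) \<le> R" using g f [of g] bdd [of "real n *\<^sub>R 2 *\<^sub>R g 0"] by auto
    then have "real n * norm (g 0) \<le> R / 2" by simp
    also have "R / 2 < real n * e" using n e by (simp add: field_simps)
    finally show ?thesis by (simp add: mult_less_cancel_left)
  qed
  ultimately show ?thesis using that [OF op] by blast
qed

text \<open>Translations carry 0 to any point, and left multiplication carries any isometry to the
  identity. So all orbit maps are \<open>S\<close>-continuous, which makes \<open>S\<close> finer
  than the pointwise topology.\<close>

private lemma orbit_at_0_suffices:
  assumes orb: "\<And>e. e > 0 \<Longrightarrow> \<exists>U. openin S U \<and> id \<in> U \<and> (\<forall>g\<in>U. norm (g 0) < e)"
  shows "S = pointwise_topology"
proof -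
  interpret group "Isom :: ('a \<Rightarrow> 'a) monoid" by (rule group_Isom)
  have "continuous_map S pointwise_topology (\<lambda>g. g)"
    unfolding continuous_map_into_pointwise_topology continuous_map_euclidean_metric
  proof (intro conjI allI ballI impI)
    fix x :: 'a and g and e :: real assume g: "g \<in> topspace S" and e: "e > 0"
    obtain U where U: "openin S U" "id \<in> U" "\<And>g. g \<in> U \<Longrightarrow> norm (g 0) < e"
      using orb [OF e] by blast
    \<comment> \<open>This word is \<open>id\<close> at \<open>h = g\<close>, and it sends 0 to
      \<open>g^-1 (h x) - x\<close>, whose norm is \<open>dist (h x) (g x)\<close>.\<close>
    let ?f = "\<lambda>h. (+) (- x) \<otimes>\<^bsub>Isom\<^esub> inv\<^bsub>Isom\<^esub> g \<otimes>\<^bsub>Isom\<^esub> h \<otimes>\<^bsub>Isom\<^esub> (+) x"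
    have "continuous_map S S ?f"
      using g by (intro group_topology_mult [OF S]) (auto simp: translation_in_Isom)
    then have op: "openin S {h \<in> topspace S. ?f h \<in> U}"
      using U(1) by (rule openin_continuous_map_preimage)
    have "?f g = id" using g by (auto simp: fun_eq_iff Isom_inv Isom_inv_into)
    then have "g \<in> {h \<in> topspace S. ?f h \<in> U}" using g U(2) by simp
    moreover have "dist (h x) (g x) < e" if h: "h \<in> {h \<in> topspace S. ?f h \<in> U}" for h
    proof -
      have "norm (?f h 0) < e" using h U(3) by blast
      then have "norm (inv_into UNIV g (h x) - x) < e" using g by (simp add: Isom_inv)
      moreover have "dist (inv_into UNIV g (h x)) x = dist (h x) (g x)"
        using Isom_dist [of g "inv_into UNIV g (h x)" x] g by (simp add: Isom_inv_into)
      ultimately show ?thesis by (simp add: dist_norm)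
    qed
    ultimately show "\<exists>U. openin S U \<and> g \<in> U \<and> (\<forall>y\<in>U. dist (y x) (g x) < e)"
      using op by blast
  qed auto
  then have "openin S {g \<in> topspace S. g \<in> U}" if "openin pointwise_topology U" for U
    using that by (rule openin_continuous_map_preimage)
  moreover have "{g \<in> topspace S. g \<in> U} = U" if "openin pointwise_topology U" for U
    using openin_subset [OF that] by auto
  ultimately have "openin S U" if "openin pointwise_topology U" for U
    using that by metis
  then show ?thesis using coarser by (auto simp: topology_eq)
qed

lemma coarser_Hausdorff_group_topology_eq:
  assumes inf: "infinite_dimensional TYPE('a)" and haus: "Hausdorff_space S"
  shows "S = pointwise_topology"
proof (cases "\<exists>W R. openin S W \<and> id \<in> W \<and> (\<forall>v. (+) v \<in> W \<longrightarrow> norm v \<le> R)")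
  case True
  then obtain W R where "openin S W" "id \<in> W" "\<And>v. (+) v \<in> W \<Longrightarrow> norm v \<le> R" by blast
  then show ?thesis
    using bounded_translations_orbit_continuous [of W R] by (intro orbit_at_0_suffices) metis
next
  case False
  \<comment> \<open>Orthogonality to the empty set is vacuous; only a nonzero vector is
    wanted.\<close>
  obtain e :: 'a where e: "e \<noteq> 0"
    using infinite_dimensional_orthogonal [OF inf, of "{}"] by auto
  have "id \<noteq> (+) e" using e by (metis add.right_neutral id_apply)
  moreover have "id \<in> topspace S" "(+) e \<in> topspace S"
    by (auto simp: translation_in_Isom Isom_carrier)
  ultimately obtain W V where W: "openin S W" "id \<in> W" "(+) e \<in> V" "disjnt W V"
    using haus unfolding Hausdorff_space_def by metis
  \<comment> \<open>The same translation lies in every neighbourhood of \<open>id\<close>, so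
    \<open>W\<close> cannot be disjoint from \<open>V\<close>.\<close>
  have "(+) e \<in> W"
    using False by (intro unbounded_translations_not_separated [OF inf _ W(1,2) e]) (meson not_le)
  then show ?thesis using W by (auto simp: disjnt_iff)
qed

end

theorem theorem1p8:
  assumes "infinite_dimensional TYPE('a::{real_inner, complete_space})"
    and "separable_space (euclidean :: 'a topology)"
  shows "Polish_group (Isom :: ('a \<Rightarrow> 'a) monoid) pointwise_topology \<and>
         minimal_group (Isom :: ('a \<Rightarrow> 'a) monoid) pointwise_topology"
proof
  show "Polish_group (Isom :: ('a \<Rightarrow> 'a) monoid) pointwise_topology"
    using assms(2) by (rule Polish_group_Isom)
  show "minimal_group (Isom :: ('a \<Rightarrow> 'a) monoid) pointwise_topology"
    unfolding minimal_group_def strictly_coarser_def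
    using group_topology_pointwise Hausdorff_pointwise coarser_Hausdorff_group_topology_eq [OF _ _ assms(1)]
    by blast
qed

end
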